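(* Let $\mathcal{H} := \operatorname{conv}\{(x, xx^T, y, y_1y_2) : x\in\mathbb{R}^2,\ y\in\{0,1\}^2,\ 0\le x\le y\}$. Then $\mathcal{H}$ equals the projection onto $(x,X,y,Y_{12})$ of the set of all $(x,X,y,Y_{12},\alpha)$ (with $x,y,\alpha\in\mathbb{R}^2$, $X$ a real symmetric $2\times 2$ matrix, $Y_{12}\in\mathbb{R}$) satisfying the convex constraints (i) $\operatorname{diag}(X)\le x\le y$; (ii) $\max\{0,\ x_1-\alpha_1+x_2-\alpha_2-Y_{12}\}\le X_{12}\le \min\{x_1-\alpha_1,\ x_2-\alpha_2\}$; (iii) $0\le\alpha_j\le y_j-Y_{12}$ for $j=1,2$; (iv) $\max\{0,\ y_1+y_2-1\}\le Y_{12}\le\min\{y_1,y_2\}$; (v) $M(\beta_{11})\succeq0$, $M(\beta_{12})\succeq0$, $M(\beta_{21})\succeq0$ and $M(\beta_{22})\succeq0$.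
   Context: Vector inequalities are componentwise; $\operatorname{diag}(X)$ is the vector of diagonal entries of $X$, $\operatorname{Diag}(\beta)$ is the diagonal matrix with diagonal $\beta$, and $\succeq 0$ means positive semidefinite. A point of $\mathcal{H}$ is written $(x,X,y,Y_{12})$, where $X$ is a symmetric $2\times2$ matrix and $Y_{12}$ is a scalar. For given $(x,X,Y_{12},\alpha)$ and $\beta\in\mathbb{R}^2$, define the symmetric $3\times3$ matrix $$M(\beta):=\begin{pmatrix} Y_{12} & (x-\alpha)^T\\ x-\alpha & X-\operatorname{Diag}(\beta)\end{pmatrix}.$$ For given $(x,X,y,Y_{12},\alpha)$, define four vectors in $\mathbb{R}^2$ (with the convention $0/0:=0$, so $(y_j-Y_{12})^{-1}\alpha_j^2:=0$ when $y_j-Y_{12}=\alpha_j=0$): $\beta_{11}:=(X_{11}-x_1+\alpha_1,\ X_{22}-x_2+\alpha_2)$, $\beta_{21}:=((y_1-Y_{12})^{-1}\alpha_1^2,\ X_{22}-x_2+\alpha_2)$, $\beta_{12}:=(X_{11}-x_1+\alpha_1,\ (y_2-Y_{12})^{-1}\alpha_2^2)$, $\beta_{22}:=((y_1-Y_{12})^{-1}\alpha_1^2,\ (y_2-Y_{12})^{-1}\alpha_2^2)$. *)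

theory Defs
  imports "HOL-Analysis.Analysis"
begin

text \<open>Throughout, \<open>\<le>\<close> on \<open>real ^ 'n\<close> is the componentwise order of the library, and
  a quintuple \<open>(x, X, y, Y, \<alpha>)\<close> carries the scalar \<open>Y\<close> in the role of \<open>Y\<^sub>1\<^sub>2\<close>.\<close>

definition psd :: "real ^ 'n ^ 'n \<Rightarrow> bool" where
  "psd A \<longleftrightarrow> transpose A = A \<and> (\<forall>v. 0 \<le> v \<bullet> (A *v v))"

definition outer_square :: "real ^ 'n \<Rightarrow> real ^ 'n ^ 'n" where
  "outer_square x = (\<chi> i j. x $ i * x $ j)"

definition diag_of :: "real ^ 'n ^ 'n \<Rightarrow> real ^ 'n" where
  "diag_of X = (\<chi> i. X $ i $ i)"

definition diag_mat :: "real ^ 'n \<Rightarrow> real ^ 'n ^ 'n" where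
  "diag_mat \<beta> = (\<chi> i j. if i = j then \<beta> $ i else 0)"

definition hull_H :: "((real ^ 2) \<times> (real ^ 2 ^ 2) \<times> (real ^ 2) \<times> real) set" where
  "hull_H = convex hull
     {(x, outer_square x, y, y $ 1 * y $ 2) | x y.
        (\<forall>j. y $ j \<in> {0, 1}) \<and> 0 \<le> x \<and> x \<le> y}"

definition M :: "real ^ 2 \<Rightarrow> real ^ 2 ^ 2 \<Rightarrow> real \<Rightarrow> real ^ 2 \<Rightarrow> real ^ 2 \<Rightarrow> real ^ 3 ^ 3" where
  "M x X Y \<alpha> \<beta> =
     (let z = x - \<alpha>; W = X - diag_mat \<beta> in
      vector [vector [Y,     z $ 1,     z $ 2],
              vector [z $ 1, W $ 1 $ 1, W $ 1 $ 2],
              vector [z $ 2, W $ 2 $ 1, W $ 2 $ 2]])"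

text \<open>The library's \<open>inverse 0 = 0\<close> realises the convention \<open>0/0 = 0\<close>; the remaining case
  \<open>y\<^sub>j = Y\<close>, \<open>\<alpha>\<^sub>j \<noteq> 0\<close> is excluded by \<open>0 \<le> \<alpha>\<^sub>j \<le> y\<^sub>j - Y\<close> in the set below.\<close>

definition beta11 :: "real ^ 2 \<Rightarrow> real ^ 2 ^ 2 \<Rightarrow> real ^ 2 \<Rightarrow> real \<Rightarrow> real ^ 2 \<Rightarrow> real ^ 2" where
  "beta11 x X y Y \<alpha> =
     vector [X $ 1 $ 1 - x $ 1 + \<alpha> $ 1, X $ 2 $ 2 - x $ 2 + \<alpha> $ 2]"

definition beta21 :: "real ^ 2 \<Rightarrow> real ^ 2 ^ 2 \<Rightarrow> real ^ 2 \<Rightarrow> real \<Rightarrow> real ^ 2 \<Rightarrow> real ^ 2" where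
  "beta21 x X y Y \<alpha> =
     vector [inverse (y $ 1 - Y) * (\<alpha> $ 1)\<^sup>2, X $ 2 $ 2 - x $ 2 + \<alpha> $ 2]"

definition beta12 :: "real ^ 2 \<Rightarrow> real ^ 2 ^ 2 \<Rightarrow> real ^ 2 \<Rightarrow> real \<Rightarrow> real ^ 2 \<Rightarrow> real ^ 2" where
  "beta12 x X y Y \<alpha> =
     vector [X $ 1 $ 1 - x $ 1 + \<alpha> $ 1, inverse (y $ 2 - Y) * (\<alpha> $ 2)\<^sup>2]"

definition beta22 :: "real ^ 2 \<Rightarrow> real ^ 2 ^ 2 \<Rightarrow> real ^ 2 \<Rightarrow> real \<Rightarrow> real ^ 2 \<Rightarrow> real ^ 2" where
  "beta22 x X y Y \<alpha> =
     vector [inverse (y $ 1 - Y) * (\<alpha> $ 1)\<^sup>2, inverse (y $ 2 - Y) * (\<alpha> $ 2)\<^sup>2]"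

definition lifted_set ::
    "((real ^ 2) \<times> (real ^ 2 ^ 2) \<times> (real ^ 2) \<times> real \<times> (real ^ 2)) set" where
  "lifted_set = {(x, X, y, Y, \<alpha>).
     transpose X = X \<and>
     diag_of X \<le> x \<and> x \<le> y \<and>
     max 0 (x $ 1 - \<alpha> $ 1 + x $ 2 - \<alpha> $ 2 - Y) \<le> X $ 1 $ 2 \<and>
     X $ 1 $ 2 \<le> min (x $ 1 - \<alpha> $ 1) (x $ 2 - \<alpha> $ 2) \<and>
     (\<forall>j. 0 \<le> \<alpha> $ j \<and> \<alpha> $ j \<le> y $ j - Y) \<and>
     max 0 (y $ 1 + y $ 2 - 1) \<le> Y \<and> Y \<le> min (y $ 1) (y $ 2) \<and>
     psd (M x X Y \<alpha> (beta11 x X y Y \<alpha>)) \<and>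
     psd (M x X Y \<alpha> (beta12 x X y Y \<alpha>)) \<and>
     psd (M x X Y \<alpha> (beta21 x X y Y \<alpha>)) \<and>
     psd (M x X Y \<alpha> (beta22 x X y Y \<alpha>))}"

end

theory Submission
  imports Defs
begin

text \<open>Split a distribution on the generators by the value of \<open>y\<close>. The four parts have weights
  \<open>Y\<close>, \<open>y\<^sub>1 - Y\<close>, \<open>y\<^sub>2 - Y\<close>, \<open>1 - y\<^sub>1 - y\<^sub>2 + Y\<close>, and \<open>\<alpha>\<^sub>j\<close> is the contribution to \<open>x\<^sub>j\<close> of the
  part where only \<open>y\<^sub>j = 1\<close>. That part contributes to \<open>X\<^sub>j\<^sub>j\<close> any \<open>a\<^sub>j\<close> between
  \<open>\<alpha>\<^sub>j\<^sup>2 / (y\<^sub>j - Y)\<close> and \<open>\<alpha>\<^sub>j\<close>. The part \<open>y = (1, 1)\<close> is left with \<open>x - \<alpha>\<close> and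
  \<open>X - Diag(a)\<close>, a scaled moment point of the box \<open>[0, 1]\<^sup>2\<close>. Such points are described by
  positive semidefiniteness, \<open>a\<^sub>j \<ge> X\<^sub>j\<^sub>j - x\<^sub>j + \<alpha>\<^sub>j\<close> and the McCormick inequalities, so the least
  admissible \<open>a\<close> is best, and it is one of the four vectors \<open>\<beta>\<close>.

  For the box itself, moving \<open>X\<^sub>1\<^sub>1\<close> and then \<open>X\<^sub>2\<^sub>2\<close> up to \<open>x\<^sub>j\<close> or down until the covariance
  \<open>X - x x\<^sup>T\<close> is singular leaves two cases. If \<open>X\<^sub>j\<^sub>j = x\<^sub>j\<close> for both \<open>j\<close>, the point is a mixture of
  the vertices of the box. If the covariance is \<open>c c\<^sup>T\<close>, a distribution on the line \<open>x + s c\<close> with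
  \<open>s\<close> of mean \<open>0\<close> and variance \<open>1\<close> is needed; where the line leaves the box through two of its
  sides, the diagonal or McCormick inequality for this pair of sides is exactly what allows it.\<close>

section \<open>Points in scalar coordinates and the generators of the hull\<close>

text \<open>Eight scalars build in the symmetry of the matrix and turn a convex combination into
  scalar identities, via \<open>scaleR_pt\<close> and \<open>add_pt\<close>.\<close>

definition pt :: "real \<Rightarrow> real \<Rightarrow> real \<Rightarrow> real \<Rightarrow> real \<Rightarrow> real \<Rightarrow> real \<Rightarrow> real
    \<Rightarrow> (real ^ 2) \<times> (real ^ 2 ^ 2) \<times> (real ^ 2) \<times> real" where
  "pt x1 x2 X11 X12 X22 y1 y2 Y =
     (vector [x1, x2], vector [vector [X11, X12], vector [X12, X22]], vector [y1, y2], Y)"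

lemma scaleR_pt:
  "u *\<^sub>R pt x1 x2 X11 X12 X22 y1 y2 Y =
     pt (u * x1) (u * x2) (u * X11) (u * X12) (u * X22) (u * y1) (u * y2) (u * Y)"
  by (simp add: pt_def vec_eq_iff forall_2)

lemma add_pt:
  "pt x1 x2 X11 X12 X22 y1 y2 Y + pt x1' x2' X11' X12' X22' y1' y2' Y' =
     pt (x1 + x1') (x2 + x2') (X11 + X11') (X12 + X12') (X22 + X22') (y1 + y1') (y2 + y2') (Y + Y')"
  by (simp add: pt_def vec_eq_iff forall_2)

lemma transpose_eq_self_2_iff: "transpose X = X \<longleftrightarrow> X $ 2 $ 1 = X $ 1 $ 2"
  for X :: "real ^ 2 ^ 2"
proof
  assume "transpose X = X"
  from arg_cong[OF this, of "\<lambda>W. W $ 1 $ 2"] show "X $ 2 $ 1 = X $ 1 $ 2"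
    by (simp add: transpose_def)
next
  assume "X $ 2 $ 1 = X $ 1 $ 2"
  then show "transpose X = X"
    by (simp add: transpose_def vec_eq_iff forall_2)
qed

lemma eq_pt:
  assumes "transpose X = X"
  shows "(x, X, y, Y) = pt (x $ 1) (x $ 2) (X $ 1 $ 1) (X $ 1 $ 2) (X $ 2 $ 2) (y $ 1) (y $ 2) Y"
  using assms[unfolded transpose_eq_self_2_iff] by (simp add: pt_def vec_eq_iff forall_2)

lemma convex_hull_H: "convex hull_H"
  by (simp add: hull_H_def)

lemma generator_in_hull_H:
  assumes "y1 \<in> {0, 1}" "y2 \<in> {0, 1}" "0 \<le> x1" "x1 \<le> y1" "0 \<le> x2" "x2 \<le> y2"
  shows "pt x1 x2 (x1 * x1) (x1 * x2) (x2 * x2) y1 y2 (y1 * y2) \<in> hull_H"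
  unfolding hull_H_def
proof (rule hull_inc, rule CollectI, intro exI conjI)
  show "pt x1 x2 (x1 * x1) (x1 * x2) (x2 * x2) y1 y2 (y1 * y2) =
      (vector [x1, x2], outer_square (vector [x1, x2]), vector [y1, y2],
       (vector [y1, y2] :: real ^ 2) $ 1 * (vector [y1, y2] :: real ^ 2) $ 2)"
    by (simp add: pt_def outer_square_def vec_eq_iff forall_2)
qed (use assms in \<open>auto simp: less_eq_vec_def forall_2\<close>)

section \<open>Rank-one covariances: two-point distributions on a line\<close>

lemma segment_in_hull_H:
  assumes y: "y1 \<in> {0, 1}" "y2 \<in> {0, 1}" and p: "p > 0"
    and l: "0 \<le> x1 - p * c1" "x1 - p * c1 \<le> y1" "0 \<le> x2 - p * c2" "x2 - p * c2 \<le> y2"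
    and r: "0 \<le> x1 + c1 / p" "x1 + c1 / p \<le> y1" "0 \<le> x2 + c2 / p" "x2 + c2 / p \<le> y2"
  shows "pt x1 x2 (x1 * x1 + c1 * c1) (x1 * x2 + c1 * c2) (x2 * x2 + c2 * c2) y1 y2 (y1 * y2)
           \<in> hull_H"
proof -
  \<comment> \<open>The distribution on the two values \<open>-p\<close> and \<open>1/p\<close> with mean \<open>0\<close> has variance \<open>1\<close>.\<close>
  define s where "s = 1 + p\<^sup>2"
  have s: "s > 0" unfolding s_def by (rule add_pos_nonneg) auto
  define u v where "u = 1 / s" and "v = p\<^sup>2 / s"
  have uv: "u \<ge> 0" "v \<ge> 0" "u + v = 1"
    using s by (auto simp: u_def v_def s_def field_simps)
  have "v = u * p\<^sup>2" by (simp add: u_def v_def)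
  then have up: "u * p = v / p" "u * p\<^sup>2 + v / p\<^sup>2 = 1"
    using p uv(3) by (auto simp: power2_eq_square)
  have mean: "u * (x - p * c) + v * (x + c / p) = x" for x c
  proof -
    have "u * (x - p * c) + v * (x + c / p) = (u + v) * x - (u * p - v / p) * c"
      by (simp add: algebra_simps)
    then show ?thesis using uv up by simp
  qed
  have second: "u * ((x - p * c) * (x' - p * c')) + v * ((x + c / p) * (x' + c' / p))
      = x * x' + c * c'" for x c x' c'
  proof -
    have "u * ((x - p * c) * (x' - p * c')) + v * ((x + c / p) * (x' + c' / p))
        = (u + v) * (x * x') - (u * p - v / p) * (x * c' + c * x')
          + (u * p\<^sup>2 + v / p\<^sup>2) * (c * c')"
      by (simp add: algebra_simps power2_eq_square add_divide_distrib)
    then show ?thesis using uv up by simp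
  qed
  have "u *\<^sub>R pt (x1 - p * c1) (x2 - p * c2) ((x1 - p * c1) * (x1 - p * c1))
          ((x1 - p * c1) * (x2 - p * c2)) ((x2 - p * c2) * (x2 - p * c2)) y1 y2 (y1 * y2)
      + v *\<^sub>R pt (x1 + c1 / p) (x2 + c2 / p) ((x1 + c1 / p) * (x1 + c1 / p))
          ((x1 + c1 / p) * (x2 + c2 / p)) ((x2 + c2 / p) * (x2 + c2 / p)) y1 y2 (y1 * y2)
      \<in> hull_H"
    by (intro convexD[OF convex_hull_H] generator_in_hull_H y l r uv)
  moreover have "u * y + v * y = y" for y
    using uv(3) by (metis distrib_right mult_1)
  ultimately show ?thesis
    by (simp only: scaleR_pt add_pt mean second)
qed

text \<open>For \<open>c > 0\<close> only the lower end can fall below 0 and only the upper end can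
  exceed 1; the latter is ruled out by \<open>c / (1 - x) \<le> p\<close>. The variance bound gives
  \<open>x < 1\<close>, so this quotient is genuine.\<close>

lemma interval_segment:
  fixes x c :: real
  assumes "c > 0" "c * c \<le> x * (1 - x)" "c / (1 - x) \<le> p" "p * c \<le> x" "p > 0" "0 \<le> x" "x \<le> 1"
  shows "0 \<le> x - p * c" "x - p * c \<le> 1" "0 \<le> x + c / p" "x + c / p \<le> 1"
proof -
  have "x * (1 - x) > 0" using assms by (smt (verit) mult_pos_pos)
  then have "x < 1" using assms by (smt (verit) mult_eq_0_iff)
  then show "x + c / p \<le> 1" using assms by (simp add: field_simps)
  show "0 \<le> x - p * c" "x - p * c \<le> 1" "0 \<le> x + c / p"
    using assms by (auto simp: algebra_simps add_increasing2)
qed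

lemma divide_le_divideI:
  fixes a b c d :: real
  assumes "a * d \<le> c * b" "b > 0" "d > 0"
  shows "a / b \<le> c / d"
  using assms by (simp add: field_simps)

text \<open>Both coordinates increase along the line, so \<open>p\<close> needs
  \<open>c / (1 - x) \<le> p \<le> x / c\<close> for each of them. Cross-multiplied,
  \<open>d\<close> makes the bounds of one coordinate compatible, and \<open>o\<close> those of
  different coordinates.\<close>

lemma rank_one_positive_in_hull_H:
  assumes c: "c1 > 0" "c2 > 0"
    and x: "0 \<le> x1" "x1 \<le> 1" "0 \<le> x2" "x2 \<le> 1"
    and d: "c1 * c1 \<le> x1 * (1 - x1)" "c2 * c2 \<le> x2 * (1 - x2)"
    and o: "c1 * c2 \<le> x1 * (1 - x2)" "c1 * c2 \<le> x2 * (1 - x1)"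
  shows "pt x1 x2 (x1 * x1 + c1 * c1) (x1 * x2 + c1 * c2) (x2 * x2 + c2 * c2) 1 1 1 \<in> hull_H"
proof -
  define p where "p = max (c1 / (1 - x1)) (c2 / (1 - x2))"
  have lt: "x1 < 1" "x2 < 1"
    using c d x by (smt (verit) mult_pos_pos mult_eq_0_iff)+
  have p: "p > 0" "c1 / (1 - x1) \<le> p" "c2 / (1 - x2) \<le> p"
    using c lt by (auto simp: p_def less_max_iff_disj)
  have "p \<le> x1 / c1" "p \<le> x2 / c2"
    unfolding p_def using c lt d o by (auto intro!: divide_le_divideI simp: mult.commute)
  then have "p * c1 \<le> x1" "p * c2 \<le> x2"
    using c by (auto simp: field_simps)
  with segment_in_hull_H[of 1 1 p x1 c1 x2 c2] interval_segment[of c1 x1 p] interval_segment[of c2 x2 p]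
  show ?thesis using p c x d by simp
qed

text \<open>The second coordinate decreases along the line. Replacing \<open>x2\<close> by
  \<open>1 - x2\<close> reduces it to an increasing one, so its bounds become
  \<open>c2 / x2 \<le> p \<le> (1 - x2) / c2\<close>.\<close>

lemma rank_one_mixed_in_hull_H:
  assumes c: "c1 > 0" "c2 > 0"
    and x: "0 \<le> x1" "x1 \<le> 1" "0 \<le> x2" "x2 \<le> 1"
    and d: "c1 * c1 \<le> x1 * (1 - x1)" "c2 * c2 \<le> x2 * (1 - x2)"
    and o: "c1 * c2 \<le> x1 * x2" "c1 * c2 \<le> (1 - x1) * (1 - x2)"
  shows "pt x1 x2 (x1 * x1 + c1 * c1) (x1 * x2 - c1 * c2) (x2 * x2 + c2 * c2) 1 1 1 \<in> hull_H"
proof -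
  define p where "p = max (c1 / (1 - x1)) (c2 / x2)"
  have lt: "x1 < 1" "x2 > 0"
    using c d x by (smt (verit) mult_pos_pos mult_eq_0_iff)+
  have p: "p > 0" "c1 / (1 - x1) \<le> p" "c2 / x2 \<le> p"
    using c lt by (auto simp: p_def less_max_iff_disj)
  have "p \<le> x1 / c1" "p \<le> (1 - x2) / c2"
    unfolding p_def using c lt d o by (auto intro!: divide_le_divideI simp: mult.commute)
  then have "p * c1 \<le> x1" "p * c2 \<le> 1 - x2"
    using c by (auto simp: field_simps)
  moreover have "0 \<le> x2 - p * - c2" "x2 - c2 / p \<le> 1"
    using x c p by (auto intro: order_trans[of _ x2])
  ultimately show ?thesis
    using segment_in_hull_H[of 1 1 p x1 c1 x2 "- c2"] interval_segment[of c1 x1 p]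
      interval_segment[of c2 "1 - x2" p] p c x d
    by (simp add: mult.commute)
qed

text \<open>The other coordinate is constant, so a one-dimensional segment suffices. Leaving
  \<open>y1\<close> and \<open>y2\<close> general serves both the box and the parts where only one
  of them is 1.\<close>

lemma rank_one_single_in_hull_H:
  assumes y: "y1 \<in> {0, 1}" "y2 \<in> {0, 1}" and x: "0 \<le> x1" "x1 \<le> y1" "0 \<le> x2" "x2 \<le> y2"
  shows "x1 * x1 \<le> X \<Longrightarrow> X \<le> x1 \<Longrightarrow> pt x1 x2 X (x1 * x2) (x2 * x2) y1 y2 (y1 * y2) \<in> hull_H"
    and "x2 * x2 \<le> X \<Longrightarrow> X \<le> x2 \<Longrightarrow> pt x1 x2 (x1 * x1) (x1 * x2) X y1 y2 (y1 * y2) \<in> hull_H"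
proof -
  have *: "\<exists>c p. p > 0 \<and> X = x * x + c * c \<and> 0 \<le> x - p * c \<and> x - p * c \<le> y \<and>
      0 \<le> x + c / p \<and> x + c / p \<le> y"
    if h: "x * x \<le> X" "X \<le> x" "0 \<le> x" "x \<le> y" "y \<in> {0, 1}" for x y X :: real
  proof -
    define c where "c = sqrt (X - x * x)"
    have c: "c * c = X - x * x" "c \<ge> 0" using h by (auto simp: c_def)
    show ?thesis
    proof (cases "c = 0")
      case True
      with h c show ?thesis by (intro exI[of _ 0] exI[of _ 1]) auto
    next
      case False
      then have c0: "c > 0" using c by simp
      \<comment> \<open>If \<open>y = 0\<close>, then \<open>x = 0\<close> and the variance
        \<open>c * c\<close> would vanish.\<close>
      have y: "y = 1"
        using h c c0 by (smt (verit) insertE mult_pos_pos mult_eq_0_iff singletonD)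
      have d: "c * c \<le> x * (1 - x)" using h c by (simp add: algebra_simps)
      have lt: "x < 1" using c0 d h y by (smt (verit) mult_pos_pos mult_eq_0_iff)
      \<comment> \<open>The witness \<open>p = c / (1 - x)\<close> puts the upper end exactly at
        1.\<close>
      have "c / (1 - x) \<le> x / c"
        using d c0 lt by (intro divide_le_divideI) auto
      then have "c / (1 - x) * c \<le> x" using c0 by (simp add: field_simps)
      with interval_segment[of c x "c / (1 - x)"] c0 d lt h c y show ?thesis
        by (intro exI[of _ c] exI[of _ "c / (1 - x)"]) auto
    qed
  qed
  show "pt x1 x2 X (x1 * x2) (x2 * x2) y1 y2 (y1 * y2) \<in> hull_H"
    if h: "x1 * x1 \<le> X" "X \<le> x1"
  proof -
    obtain c p where "p > 0" "X = x1 * x1 + c * c" "0 \<le> x1 - p * c" "x1 - p * c \<le> y1"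
      "0 \<le> x1 + c / p" "x1 + c / p \<le> y1"
      using *[OF h x(1,2) y(1)] by blast
    with segment_in_hull_H[of y1 y2 p x1 c x2 0] y x show ?thesis by simp
  qed
  show "pt x1 x2 (x1 * x1) (x1 * x2) X y1 y2 (y1 * y2) \<in> hull_H"
    if h: "x2 * x2 \<le> X" "X \<le> x2"
  proof -
    obtain c p where "p > 0" "X = x2 * x2 + c * c" "0 \<le> x2 - p * c" "x2 - p * c \<le> y2"
      "0 \<le> x2 + c / p" "x2 + c / p \<le> y2"
      using *[OF h x(3,4) y(2)] by blast
    with segment_in_hull_H[of y1 y2 p x1 0 x2 c] y x show ?thesis by simp
  qed
qed

text \<open>A singular covariance has off-diagonal entry plus or minus \<open>c1 * c2\<close>, with
  \<open>c1\<close>, \<open>c2\<close> the standard deviations. The sign decides whether the line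
  rises or falls; the upper McCormick bounds serve the rising case, the lower ones the falling
  case.\<close>

lemma rank_one_in_hull_H:
  assumes x: "0 \<le> x1" "x1 \<le> 1" "0 \<le> x2" "x2 \<le> 1"
    and d: "x1 * x1 \<le> X11" "X11 \<le> x1" "x2 * x2 \<le> X22" "X22 \<le> x2"
    and o: "0 \<le> X12" "x1 + x2 - 1 \<le> X12" "X12 \<le> x1" "X12 \<le> x2"
    and det: "(X12 - x1 * x2)\<^sup>2 = (X11 - x1 * x1) * (X22 - x2 * x2)"
  shows "pt x1 x2 X11 X12 X22 1 1 1 \<in> hull_H"
proof -
  define c1 c2 where "c1 = sqrt (X11 - x1 * x1)" and "c2 = sqrt (X22 - x2 * x2)"
  have c: "c1 \<ge> 0" "c2 \<ge> 0" "X11 = x1 * x1 + c1 * c1" "X22 = x2 * x2 + c2 * c2"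
    using d by (auto simp: c1_def c2_def)
  have "(X12 - x1 * x2)\<^sup>2 = (c1 * c2)\<^sup>2"
    using det c by (simp add: power2_eq_square)
  then consider "X12 = x1 * x2 + c1 * c2" | "X12 = x1 * x2 - c1 * c2"
    by (force simp: power2_eq_iff)
  note cases = this
  consider "c1 = 0" | "c2 = 0" | "c1 > 0" "c2 > 0" using c by linarith
  then show ?thesis
  proof cases
    case 1
    then show ?thesis using cases rank_one_single_in_hull_H(2)[of 1 1 x1 x2 X22] x d c by auto
  next
    case 2
    then show ?thesis using cases rank_one_single_in_hull_H(1)[of 1 1 x1 x2 X11] x d c by auto
  next
    case 3
    from cases show ?thesis
    proof cases
      case 1
      with 3 show ?thesis
        unfolding c(3,4) 1 using x d o c 1 by (intro rank_one_positive_in_hull_H) (auto simp: algebra_simps)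
    next
      case 2
      with 3 show ?thesis
        unfolding c(3,4) 2 using x d o c 2 by (intro rank_one_mixed_in_hull_H) (auto simp: algebra_simps)
    qed
  qed
qed

section \<open>Moment points of the unit box\<close>

lemma convex_combination4:
  assumes "convex S" "a \<in> S" "b \<in> S" "c \<in> S" "d \<in> S"
    and "0 \<le> s" "0 \<le> t" "0 \<le> u" "0 \<le> v" "s + t + u + v = (1::real)"
  shows "s *\<^sub>R a + t *\<^sub>R b + u *\<^sub>R c + v *\<^sub>R d \<in> S"
proof -
  have "(\<Sum>i<4. [s, t, u, v] ! i *\<^sub>R [a, b, c, d] ! i) \<in> S"
    using assms
    by (intro convex_sum) (auto simp: eval_nat_numeral less_Suc_eq)
  then show ?thesis by (simp add: eval_nat_numeral)
qed

text \<open>The four weights are the joint law of two 0/1 variables with means \<open>x1\<close>,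
  \<open>x2\<close> and product mean \<open>X12\<close>; the hypotheses are exactly their
  nonnegativity.\<close>

lemma vertices_in_hull_H:
  assumes "0 \<le> X12" "x1 + x2 - 1 \<le> X12" "X12 \<le> x1" "X12 \<le> x2"
  shows "pt x1 x2 x1 X12 x2 1 1 1 \<in> hull_H"
proof -
  have "X12 *\<^sub>R pt 1 1 1 1 1 1 1 1 + (x1 - X12) *\<^sub>R pt 1 0 1 0 0 1 1 1
      + (x2 - X12) *\<^sub>R pt 0 1 0 0 1 1 1 1 + (1 - x1 - x2 + X12) *\<^sub>R pt 0 0 0 0 0 1 1 1 \<in> hull_H"
    using assms generator_in_hull_H[of 1 1 1 1] generator_in_hull_H[of 1 1 1 0]
      generator_in_hull_H[of 1 1 0 1] generator_in_hull_H[of 1 1 0 0]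
    by (intro convex_combination4 convex_hull_H) auto
  then show ?thesis by (simp add: scaleR_pt add_pt)
qed

lemma between_in_hull_H:
  assumes "l \<le> X" "X \<le> r"
  shows "pt x1 x2 l X12 X22 y1 y2 Y \<in> hull_H \<Longrightarrow> pt x1 x2 r X12 X22 y1 y2 Y \<in> hull_H
      \<Longrightarrow> pt x1 x2 X X12 X22 y1 y2 Y \<in> hull_H"
    and "pt x1 x2 X11 X12 l y1 y2 Y \<in> hull_H \<Longrightarrow> pt x1 x2 X11 X12 r y1 y2 Y \<in> hull_H
      \<Longrightarrow> pt x1 x2 X11 X12 X y1 y2 Y \<in> hull_H"
proof -
  have "X \<in> closed_segment l r" using assms by (simp add: closed_segment_eq_real_ivl)
  then obtain u where u: "0 \<le> u" "u \<le> 1" "X = (1 - u) * l + u * r"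
    by (auto simp: closed_segment_def)
  have aff: "(1 - u) * a + u * a = a" for a by (simp add: algebra_simps)
  show "pt x1 x2 X X12 X22 y1 y2 Y \<in> hull_H"
    if "pt x1 x2 l X12 X22 y1 y2 Y \<in> hull_H" "pt x1 x2 r X12 X22 y1 y2 Y \<in> hull_H"
    using convexD[OF convex_hull_H that, of "1 - u" u] u by (simp add: scaleR_pt add_pt aff)
  show "pt x1 x2 X11 X12 X y1 y2 Y \<in> hull_H"
    if "pt x1 x2 X11 X12 l y1 y2 Y \<in> hull_H" "pt x1 x2 X11 X12 r y1 y2 Y \<in> hull_H"
    using convexD[OF convex_hull_H that, of "1 - u" u] u by (simp add: scaleR_pt add_pt aff)
qed

text \<open>Two interpolations. The second diagonal entry lies between the value \<open>l\<close>
  that makes the covariance singular and \<open>x2\<close>; at \<open>x2\<close>, the first entry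
  lies between its own singular value and \<open>x1\<close>, where the point is a mixture of
  vertices.\<close>

lemma box_in_hull_H:
  assumes d: "x1 * x1 \<le> X11" "X11 \<le> x1" "x2 * x2 \<le> X22" "X22 \<le> x2"
    and o: "0 \<le> X12" "x1 + x2 - 1 \<le> X12" "X12 \<le> x1" "X12 \<le> x2"
    and det: "(X12 - x1 * x2)\<^sup>2 \<le> (X11 - x1 * x1) * (X22 - x2 * x2)"
  shows "pt x1 x2 X11 X12 X22 1 1 1 \<in> hull_H"
proof -
  have x: "0 \<le> x1" "x1 \<le> 1" "0 \<le> x2" "x2 \<le> 1"
    using d o by (smt (verit) mult_le_cancel_left1)+
  define e where "e = (X12 - x1 * x2)\<^sup>2"
  have e0: "e \<ge> 0" by (simp add: e_def)
  have tight: "pt x1 x2 X11 X12 x2 1 1 1 \<in> hull_H"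
    if det: "e \<le> (X11 - x1 * x1) * (x2 - x2 * x2)"
  \<comment> \<open>A zero variance forces \<open>e = 0\<close>, so the covariance is already
    singular; otherwise division by it gives the singular value \<open>l\<close>.\<close>
  proof (cases "x2 - x2 * x2 = 0")
    case True
    with det e0 have "e = 0" by simp
    with True d o x show ?thesis
      by (intro rank_one_in_hull_H) (auto simp: e_def)
  next
    case False
    then have pos: "x2 - x2 * x2 > 0" using d by linarith
    define l where "l = x1 * x1 + e / (x2 - x2 * x2)"
    have q: "x1 * x1 + t \<le> X11 \<longleftrightarrow> t \<le> X11 - x1 * x1" for t by auto
    have l: "x1 * x1 \<le> l" "l \<le> X11" "e = (l - x1 * x1) * (x2 - x2 * x2)"
      using pos divide_nonneg_pos[OF e0 pos] det by (auto simp: l_def pos_divide_le_eq q)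
    have "pt x1 x2 l X12 x2 1 1 1 \<in> hull_H"
      using l pos d o x by (intro rank_one_in_hull_H) (auto simp: e_def)
    then show ?thesis
      using l d o by (intro between_in_hull_H(1)[of l X11 x1] vertices_in_hull_H) auto
  qed
  show ?thesis
  proof (cases "X11 - x1 * x1 = 0")
    case True
    with det e0 have "e = 0" by (simp add: e_def)
    with True d o x show ?thesis
      by (intro rank_one_in_hull_H) (auto simp: e_def)
  next
    case False
    then have pos: "X11 - x1 * x1 > 0" using d by linarith
    define l where "l = x2 * x2 + e / (X11 - x1 * x1)"
    have q: "x2 * x2 + t \<le> X22 \<longleftrightarrow> t \<le> X22 - x2 * x2" for t by auto
    have l: "x2 * x2 \<le> l" "l \<le> X22" "e = (X11 - x1 * x1) * (l - x2 * x2)"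
      using pos divide_nonneg_pos[OF e0 pos] det[folded e_def]
      by (auto simp: l_def pos_divide_le_eq q mult.commute)
    have "pt x1 x2 X11 X12 l 1 1 1 \<in> hull_H"
      using l pos d o x by (intro rank_one_in_hull_H) (auto simp: e_def)
    moreover have "e \<le> (X11 - x1 * x1) * (x2 - x2 * x2)"
      unfolding l(3) using pos l d by (intro mult_left_mono) auto
    ultimately show ?thesis
      using l d by (intro between_in_hull_H(2)[of l X22 x2] tight) auto
  qed
qed

section \<open>Semidefinite matrices as ternary quadratic forms\<close>

text \<open>The form at \<open>(a, b, c)\<close> of the symmetric matrix with rows
  \<open>(Y, z1, z2)\<close>, \<open>(z1, A, B)\<close>, \<open>(z2, B, C)\<close>. It is linear in
  the six entries, which makes monotonicity and conic combinations immediate.\<close>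

definition psd3 :: "real \<Rightarrow> real \<Rightarrow> real \<Rightarrow> real \<Rightarrow> real \<Rightarrow> real \<Rightarrow> bool" where
  "psd3 Y z1 z2 A B C \<longleftrightarrow>
     (\<forall>a b c. 0 \<le> Y * a\<^sup>2 + 2 * z1 * a * b + 2 * z2 * a * c + A * b\<^sup>2 + 2 * B * b * c + C * c\<^sup>2)"

lemma psd_M_iff:
  assumes "X $ 2 $ 1 = X $ 1 $ 2"
  shows "psd (M x X Y \<alpha> \<beta>) \<longleftrightarrow>
    psd3 Y (x $ 1 - \<alpha> $ 1) (x $ 2 - \<alpha> $ 2) (X $ 1 $ 1 - \<beta> $ 1) (X $ 1 $ 2) (X $ 2 $ 2 - \<beta> $ 2)"
proof -
  have sym: "transpose (M x X Y \<alpha> \<beta>) = M x X Y \<alpha> \<beta>"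
    using assms by (simp add: M_def Let_def transpose_def vec_eq_iff forall_3 diag_mat_def)
  have q: "v \<bullet> (M x X Y \<alpha> \<beta> *v v) =
      Y * (v $ 1)\<^sup>2 + 2 * (x $ 1 - \<alpha> $ 1) * v $ 1 * v $ 2 + 2 * (x $ 2 - \<alpha> $ 2) * v $ 1 * v $ 3
      + (X $ 1 $ 1 - \<beta> $ 1) * (v $ 2)\<^sup>2 + 2 * (X $ 1 $ 2) * v $ 2 * v $ 3
      + (X $ 2 $ 2 - \<beta> $ 2) * (v $ 3)\<^sup>2" for v
    using assms
    by (simp add: M_def Let_def inner_vec_def matrix_vector_mult_def sum_3 diag_mat_def
        power2_eq_square algebra_simps)
  show ?thesis
  proof
    assume "psd (M x X Y \<alpha> \<beta>)"
    then have "0 \<le> vector [a, b, c] \<bullet> (M x X Y \<alpha> \<beta> *v vector [a, b, c])" for a b c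
      by (simp add: psd_def)
    then show "psd3 Y (x $ 1 - \<alpha> $ 1) (x $ 2 - \<alpha> $ 2) (X $ 1 $ 1 - \<beta> $ 1) (X $ 1 $ 2)
        (X $ 2 $ 2 - \<beta> $ 2)"
      unfolding q by (simp add: psd3_def)
  next
    assume "psd3 Y (x $ 1 - \<alpha> $ 1) (x $ 2 - \<alpha> $ 2) (X $ 1 $ 1 - \<beta> $ 1) (X $ 1 $ 2)
        (X $ 2 $ 2 - \<beta> $ 2)"
    with sym show "psd (M x X Y \<alpha> \<beta>)"
      by (simp add: psd_def psd3_def q)
  qed
qed

lemma psd3_diag_mono:
  assumes "psd3 Y z1 z2 A B C" "A \<le> A'" "C \<le> C'"
  shows "psd3 Y z1 z2 A' B C'"
  unfolding psd3_def
proof (intro allI)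
  fix a b c
  have "0 \<le> Y * a\<^sup>2 + 2 * z1 * a * b + 2 * z2 * a * c + A * b\<^sup>2 + 2 * B * b * c + C * c\<^sup>2"
    using assms(1) by (auto simp: psd3_def)
  moreover have "A * b\<^sup>2 \<le> A' * b\<^sup>2" "C * c\<^sup>2 \<le> C' * c\<^sup>2"
    using assms by (auto intro: mult_right_mono)
  ultimately show "0 \<le> Y * a\<^sup>2 + 2 * z1 * a * b + 2 * z2 * a * c + A' * b\<^sup>2 + 2 * B * b * c + C' * c\<^sup>2"
    by linarith
qed

lemma psd3_comb:
  assumes "psd3 Y z1 z2 A B C" "psd3 Y' z1' z2' A' B' C'" "0 \<le> u" "0 \<le> v"
  shows "psd3 (u * Y + v * Y') (u * z1 + v * z1') (u * z2 + v * z2')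
      (u * A + v * A') (u * B + v * B') (u * C + v * C')"
  unfolding psd3_def
proof (intro allI)
  fix a b c
  have "0 \<le> u * (Y * a\<^sup>2 + 2 * z1 * a * b + 2 * z2 * a * c + A * b\<^sup>2 + 2 * B * b * c + C * c\<^sup>2)
      + v * (Y' * a\<^sup>2 + 2 * z1' * a * b + 2 * z2' * a * c + A' * b\<^sup>2 + 2 * B' * b * c + C' * c\<^sup>2)"
    using assms by (auto simp: psd3_def)
  also have "\<dots> = (u * Y + v * Y') * a\<^sup>2 + 2 * (u * z1 + v * z1') * a * b
      + 2 * (u * z2 + v * z2') * a * c + (u * A + v * A') * b\<^sup>2 + 2 * (u * B + v * B') * b * c
      + (u * C + v * C') * c\<^sup>2"
    by (simp add: algebra_simps)
  finally show "0 \<le> \<dots>" .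
qed

lemma binary_form_discriminant:
  fixes A B C :: real
  assumes "\<And>b c. 0 \<le> A * b\<^sup>2 + 2 * B * b * c + C * c\<^sup>2"
  shows "0 \<le> A" "0 \<le> C" "B\<^sup>2 \<le> A * C"
proof -
  show A: "0 \<le> A" using assms[of 1 0] by simp
  show "0 \<le> C" using assms[of 0 1] by simp
  show "B\<^sup>2 \<le> A * C"
  proof (cases "A = 0")
    case True
    \<comment> \<open>The form is linear in \<open>b\<close> here; this point gives
      \<open>- 4 * B\<^sup>2\<close>.\<close>
    have "0 \<le> - B\<^sup>2"
      using assms[of "- (C + 1)" "2 * B"] True by (simp add: power2_eq_square algebra_simps)
    then show ?thesis using True by simp
  next
    case False
    \<comment> \<open>The point \<open>(- B, A)\<close> gives \<open>A\<close> times the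
      determinant.\<close>
    have "0 \<le> A * (A * C - B\<^sup>2)"
      using assms[of "- B" A] by (simp add: power2_eq_square algebra_simps)
    then show ?thesis using A False by (simp add: zero_le_mult_iff)
  qed
qed

text \<open>\<open>a = - (z1 * b + z2 * c)\<close> minimises the form over \<open>a\<close>; what
  remains is the form of the Schur complement of the corner entry 1.\<close>

lemma psd3_schur:
  assumes "psd3 1 z1 z2 A B C"
  shows "z1 * z1 \<le> A" "z2 * z2 \<le> C" "(B - z1 * z2)\<^sup>2 \<le> (A - z1 * z1) * (C - z2 * z2)"
proof -
  have "0 \<le> (A - z1 * z1) * b\<^sup>2 + 2 * (B - z1 * z2) * b * c + (C - z2 * z2) * c\<^sup>2" for b c
    using assms[unfolded psd3_def, rule_format, of "- (z1 * b + z2 * c)" b c]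
    by (simp add: power2_eq_square algebra_simps)
  from binary_form_discriminant[OF this]
  show "z1 * z1 \<le> A" "z2 * z2 \<le> C" "(B - z1 * z2)\<^sup>2 \<le> (A - z1 * z1) * (C - z2 * z2)"
    by auto
qed

section \<open>Weighted parts of the hull, including weight zero\<close>

lemma zero_in_hull_H: "pt 0 0 0 0 0 0 0 0 \<in> hull_H"
  using generator_in_hull_H[of 0 0 0 0] by simp

text \<open>Division by \<open>Y\<close> reduces to \<open>box_in_hull_H\<close>, with
  \<open>psd3_schur\<close> supplying the covariance inequalities. The existential form admits
  weight 0.\<close>

lemma scaled_box_in_hull_H:
  assumes psd: "psd3 Y z1 z2 A B C" and Y: "0 \<le> Y" and d: "A \<le> z1" "C \<le> z2"
    and o: "0 \<le> B" "z1 + z2 - Y \<le> B" "B \<le> z1" "B \<le> z2"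
  shows "\<exists>p\<in>hull_H. Y *\<^sub>R p = pt z1 z2 A B C Y Y Y"
proof (cases "Y = 0")
  case True
  have "0 \<le> A" "0 \<le> C"
    using psd[unfolded psd3_def, rule_format, of 0 1 0] psd[unfolded psd3_def, rule_format, of 0 0 1]
    by auto
  \<comment> \<open>At \<open>Y = 0\<close> the inequalities on \<open>B\<close> force
    \<open>z1 = z2 = B = 0\<close>, and each diagonal entry is squeezed between 0 and
    \<open>z1\<close> or \<open>z2\<close>.\<close>
  with psd d o have z: "z1 = 0" "z2 = 0" "A = 0" "B = 0" "C = 0"
    using psd3_schur[of z1 z2 A B C] unfolding True by auto
  show ?thesis
    unfolding True using zero_in_hull_H z
    by (intro bexI[of _ "pt 0 0 0 0 0 0 0 0"]) (auto simp: scaleR_pt)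
next
  case False
  then have Y: "Y > 0" using Y by simp
  have "psd3 1 (z1 / Y) (z2 / Y) (A / Y) (B / Y) (C / Y)"
    using psd3_comb[OF psd psd, of "1 / Y" 0] Y by simp
  from psd3_schur[OF this] have "pt (z1 / Y) (z2 / Y) (A / Y) (B / Y) (C / Y) 1 1 1 \<in> hull_H"
    using Y d o divide_right_mono[OF o(2), of Y]
    by (intro box_in_hull_H) (auto simp: divide_right_mono diff_divide_distrib add_divide_distrib)
  then show ?thesis using Y
    by (intro bexI[of _ "pt (z1 / Y) (z2 / Y) (A / Y) (B / Y) (C / Y) 1 1 1"]) (auto simp: scaleR_pt)
qed

text \<open>After division by \<open>w\<close>, \<open>a\<close> is a second moment between the
  squared mean and the mean on \<open>[0, 1]\<close>. At \<open>w = 0\<close>,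
  \<open>inverse 0 = 0\<close> and the bounds force \<open>r = a = 0\<close>.\<close>

lemma scaled_edge_in_hull_H:
  assumes "0 \<le> w" "0 \<le> r" "r \<le> w" "inverse w * r\<^sup>2 \<le> a" "a \<le> r"
  shows "\<exists>p\<in>hull_H. w *\<^sub>R p = pt r 0 a 0 0 w 0 0" "\<exists>p\<in>hull_H. w *\<^sub>R p = pt 0 r 0 0 a 0 w 0"
proof -
  have "(\<exists>p\<in>hull_H. w *\<^sub>R p = pt r 0 a 0 0 w 0 0) \<and> (\<exists>p\<in>hull_H. w *\<^sub>R p = pt 0 r 0 0 a 0 w 0)"
  proof (cases "w = 0")
    case True
    then have "r = 0" "a = 0" using assms by auto
    then show ?thesis using True zero_in_hull_H
      by (intro conjI bexI[of _ "pt 0 0 0 0 0 0 0 0"]) (simp_all add: scaleR_pt)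
  next
    case False
    then have w: "w > 0" using assms by simp
    have *: "r / w * (r / w) \<le> a / w"
      using assms(4) w by (simp add: field_simps power2_eq_square)
    have "pt (r / w) 0 (a / w) 0 0 1 0 0 \<in> hull_H" "pt 0 (r / w) 0 0 (a / w) 0 1 0 \<in> hull_H"
      using rank_one_single_in_hull_H(1)[of 1 0 "r / w" 0 "a / w"]
        rank_one_single_in_hull_H(2)[of 0 1 0 "r / w" "a / w"]
        assms w * by (auto simp: divide_right_mono)
    then show ?thesis using w
      by (intro conjI bexI[of _ "pt (r / w) 0 (a / w) 0 0 1 0 0"]
          bexI[of _ "pt 0 (r / w) 0 0 (a / w) 0 1 0"]) (auto simp: scaleR_pt)
  qed
  then show "\<exists>p\<in>hull_H. w *\<^sub>R p = pt r 0 a 0 0 w 0 0" "\<exists>p\<in>hull_H. w *\<^sub>R p = pt 0 r 0 0 a 0 w 0"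
    by auto
qed

section \<open>Membership in the lifted set and passage to the hull\<close>

text \<open>Subtracting the vectors \<beta> leaves one of two values in each diagonal entry, chosen
  independently; hence the four matrices form a product of two-element sets.\<close>

lemma in_lifted_set_iff:
  "(x, X, y, Y, \<alpha>) \<in> lifted_set \<longleftrightarrow>
     X $ 2 $ 1 = X $ 1 $ 2 \<and>
     X $ 1 $ 1 \<le> x $ 1 \<and> X $ 2 $ 2 \<le> x $ 2 \<and> x $ 1 \<le> y $ 1 \<and> x $ 2 \<le> y $ 2 \<and>
     0 \<le> X $ 1 $ 2 \<and> x $ 1 - \<alpha> $ 1 + x $ 2 - \<alpha> $ 2 - Y \<le> X $ 1 $ 2 \<and>
     X $ 1 $ 2 \<le> x $ 1 - \<alpha> $ 1 \<and> X $ 1 $ 2 \<le> x $ 2 - \<alpha> $ 2 \<and>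
     0 \<le> \<alpha> $ 1 \<and> \<alpha> $ 1 \<le> y $ 1 - Y \<and> 0 \<le> \<alpha> $ 2 \<and> \<alpha> $ 2 \<le> y $ 2 - Y \<and>
     0 \<le> Y \<and> y $ 1 + y $ 2 - 1 \<le> Y \<and>
     (\<forall>A \<in> {x $ 1 - \<alpha> $ 1, X $ 1 $ 1 - inverse (y $ 1 - Y) * (\<alpha> $ 1)\<^sup>2}.
      \<forall>C \<in> {x $ 2 - \<alpha> $ 2, X $ 2 $ 2 - inverse (y $ 2 - Y) * (\<alpha> $ 2)\<^sup>2}.
        psd3 Y (x $ 1 - \<alpha> $ 1) (x $ 2 - \<alpha> $ 2) A (X $ 1 $ 2) C)"
proof -
  have "(psd (M x X Y \<alpha> (beta11 x X y Y \<alpha>)) \<and> psd (M x X Y \<alpha> (beta12 x X y Y \<alpha>)) \<and>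
      psd (M x X Y \<alpha> (beta21 x X y Y \<alpha>)) \<and> psd (M x X Y \<alpha> (beta22 x X y Y \<alpha>))) \<longleftrightarrow>
    (\<forall>A \<in> {x $ 1 - \<alpha> $ 1, X $ 1 $ 1 - inverse (y $ 1 - Y) * (\<alpha> $ 1)\<^sup>2}.
      \<forall>C \<in> {x $ 2 - \<alpha> $ 2, X $ 2 $ 2 - inverse (y $ 2 - Y) * (\<alpha> $ 2)\<^sup>2}.
        psd3 Y (x $ 1 - \<alpha> $ 1) (x $ 2 - \<alpha> $ 2) A (X $ 1 $ 2) C)" if "X $ 2 $ 1 = X $ 1 $ 2"
    using that by (simp add: psd_M_iff beta11_def beta12_def beta21_def beta22_def)
  moreover have "Y \<le> y $ 1 \<and> Y \<le> y $ 2"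
    if "0 \<le> \<alpha> $ 1" "\<alpha> $ 1 \<le> y $ 1 - Y" "0 \<le> \<alpha> $ 2" "\<alpha> $ 2 \<le> y $ 2 - Y"
    using that by linarith
  moreover have "diag_of X \<le> x \<longleftrightarrow> X $ 1 $ 1 \<le> x $ 1 \<and> X $ 2 $ 2 \<le> x $ 2"
    "x \<le> y \<longleftrightarrow> x $ 1 \<le> y $ 1 \<and> x $ 2 \<le> y $ 2"
    by (simp_all add: less_eq_vec_def diag_of_def forall_2)
  ultimately show ?thesis
    unfolding lifted_set_def mem_Collect_eq case_prod_conv forall_2 max.bounded_iff min.bounded_iff
      transpose_eq_self_2_iff
    by blast
qed

lemma lifted_set_imp_hull_H:
  assumes "(x, X, y, Y, \<alpha>) \<in> lifted_set"
  shows "(x, X, y, Y) \<in> hull_H"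
proof -
  note lift = assms[unfolded in_lifted_set_iff]
  have tr: "transpose X = X"
    using lift by (simp add: transpose_eq_self_2_iff)
  \<comment> \<open>Each is the larger of two lower bounds; whichever term attains the maximum, the
    resulting matrix is among the four assumed to be semidefinite.\<close>
  define a1 a2 where
    "a1 = max (X $ 1 $ 1 - x $ 1 + \<alpha> $ 1) (inverse (y $ 1 - Y) * (\<alpha> $ 1)\<^sup>2)" and
    "a2 = max (X $ 2 $ 2 - x $ 2 + \<alpha> $ 2) (inverse (y $ 2 - Y) * (\<alpha> $ 2)\<^sup>2)"
  have X: "X $ 1 $ 1 \<le> x $ 1" "X $ 2 $ 2 \<le> x $ 2"
    and \<alpha>: "0 \<le> \<alpha> $ 1" "\<alpha> $ 1 \<le> y $ 1 - Y" "0 \<le> \<alpha> $ 2" "\<alpha> $ 2 \<le> y $ 2 - Y"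
    and Y: "0 \<le> Y" "y $ 1 + y $ 2 - 1 \<le> Y"
    and o: "0 \<le> X $ 1 $ 2" "x $ 1 - \<alpha> $ 1 + x $ 2 - \<alpha> $ 2 - Y \<le> X $ 1 $ 2"
      "X $ 1 $ 2 \<le> x $ 1 - \<alpha> $ 1" "X $ 1 $ 2 \<le> x $ 2 - \<alpha> $ 2"
    using lift by blast+
  have psd: "psd3 Y (x $ 1 - \<alpha> $ 1) (x $ 2 - \<alpha> $ 2) (X $ 1 $ 1 - a1) (X $ 1 $ 2) (X $ 2 $ 2 - a2)"
    using lift by (simp add: a1_def a2_def max_def)
  \<comment> \<open>This keeps the lower bounds below \<alpha>; for \<open>w = 0\<close> both sides
    vanish.\<close>
  have qol: "inverse w * r\<^sup>2 \<le> r" if "0 \<le> r" "r \<le> w" for w r :: real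
    using that mult_left_mono[of r w r] by (cases "w = 0") (auto simp: field_simps power2_eq_square)
  have a: "a1 \<le> \<alpha> $ 1" "a2 \<le> \<alpha> $ 2"
    using X \<alpha> by (auto simp: a1_def a2_def qol)
  have "X $ 1 $ 1 - a1 \<le> x $ 1 - \<alpha> $ 1" "X $ 2 $ 2 - a2 \<le> x $ 2 - \<alpha> $ 2"
    by (auto simp: a1_def a2_def)
  from scaled_box_in_hull_H[OF psd Y(1) this] o
  obtain p11 where p11: "p11 \<in> hull_H" "Y *\<^sub>R p11 = pt (x $ 1 - \<alpha> $ 1) (x $ 2 - \<alpha> $ 2)
      (X $ 1 $ 1 - a1) (X $ 1 $ 2) (X $ 2 $ 2 - a2) Y Y Y"
    by auto
  obtain p10 where p10: "p10 \<in> hull_H" "(y $ 1 - Y) *\<^sub>R p10 = pt (\<alpha> $ 1) 0 a1 0 0 (y $ 1 - Y) 0 0"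
    using scaled_edge_in_hull_H(1)[of "y $ 1 - Y" "\<alpha> $ 1" a1] \<alpha> a a1_def by auto
  obtain p01 where p01: "p01 \<in> hull_H" "(y $ 2 - Y) *\<^sub>R p01 = pt 0 (\<alpha> $ 2) 0 0 a2 0 (y $ 2 - Y) 0"
    using scaled_edge_in_hull_H(2)[of "y $ 2 - Y" "\<alpha> $ 2" a2] \<alpha> a a2_def by auto
  \<comment> \<open>The remaining weight belongs to \<open>y = (0, 0)\<close>, whose only generator
    is the zero point.\<close>
  have "Y *\<^sub>R p11 + (y $ 1 - Y) *\<^sub>R p10 + (y $ 2 - Y) *\<^sub>R p01
      + (1 - y $ 1 - y $ 2 + Y) *\<^sub>R pt 0 0 0 0 0 0 0 0 \<in> hull_H"
    using p11(1) p10(1) p01(1) zero_in_hull_H Y \<alpha>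
    by (intro convex_combination4 convex_hull_H) auto
  then show ?thesis
    unfolding p11(2) p10(2) p01(2) eq_pt[OF tr, of x y Y] by (simp add: scaleR_pt add_pt)
qed

section \<open>Convexity of the lifted set\<close>

lemma quad_over_linear_convex:
  fixes a b s t u v :: real
  assumes "0 \<le> a" "a \<le> s" "0 \<le> b" "b \<le> t" "0 \<le> u" "0 \<le> v"
  shows "inverse (u * s + v * t) * (u * a + v * b)\<^sup>2
      \<le> u * (inverse s * a\<^sup>2) + v * (inverse t * b\<^sup>2)"
proof -
  define f where "f s a = inverse s * a\<^sup>2" for s a :: real
  \<comment> \<open>\<open>a\<^sup>2 / s\<close> is the supremum over \<open>k\<close> of these linear functions.\<close>
  have supp: "2 * k * a - k\<^sup>2 * s \<le> f s a" if "0 \<le> a" "a \<le> s" for k s a :: real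
  proof (cases "s = 0")
    case False
    then have "s > 0" using that by simp
    moreover have "0 \<le> (a - k * s)\<^sup>2" by simp
    ultimately show ?thesis
      by (simp add: f_def field_simps power2_eq_square)
  qed (use that in \<open>simp add: f_def\<close>)
  define S A where "S = u * s + v * t" and "A = u * a + v * b"
  \<comment> \<open>The supremum at the combined point is attained here; if \<open>S = 0\<close>,
    the default \<open>k = 0\<close> works, since both sides are 0.\<close>
  define k where "k = A / S"
  have "f S A = 2 * k * A - k\<^sup>2 * S"
    by (cases "S = 0") (auto simp: k_def f_def field_simps power2_eq_square)
  also have "\<dots> = u * (2 * k * a - k\<^sup>2 * s) + v * (2 * k * b - k\<^sup>2 * t)"
    by (simp add: S_def A_def algebra_simps)
  also have "\<dots> \<le> u * f s a + v * f t b"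
    using supp assms by (intro add_mono mult_left_mono) auto
  finally show ?thesis by (simp add: f_def S_def A_def)
qed

text \<open>\<open>X $ j $ j - inverse (y $ j - Y) * (\<alpha> $ j)\<^sup>2\<close> is concave where
  \<open>0 \<le> \<alpha> $ j \<le> y $ j - Y\<close>. So each diagonal choice at the combined point
  dominates the combination of the same choices at the two points, and semidefiniteness survives by
  \<open>psd3_comb\<close> and \<open>psd3_diag_mono\<close>.\<close>

lemma convex_lifted_set: "convex lifted_set"
proof (rule convexI, clarify)
  fix x x' y y' \<alpha> \<alpha>' :: "real ^ 2" and X X' :: "real ^ 2 ^ 2" and Y Y' u v :: real
  assume uv: "0 \<le> u" "0 \<le> v" "u + v = 1"
  assume "(x, X, y, Y, \<alpha>) \<in> lifted_set" "(x', X', y', Y', \<alpha>') \<in> lifted_set"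
  note h = this[unfolded in_lifted_set_iff]
  have mono: "u * a + v * a' \<le> u * b + v * b'" if "a \<le> b" "a' \<le> b'" for a a' b b' :: real
    using that uv by (intro add_mono mult_left_mono)
  have psd: "psd3 (u * Y + v * Y')
      (u * (x $ 1 - \<alpha> $ 1) + v * (x' $ 1 - \<alpha>' $ 1)) (u * (x $ 2 - \<alpha> $ 2) + v * (x' $ 2 - \<alpha>' $ 2))
      A (u * X $ 1 $ 2 + v * X' $ 1 $ 2) C"
    if A: "A \<in> {u * (x $ 1 - \<alpha> $ 1) + v * (x' $ 1 - \<alpha>' $ 1),
        u * X $ 1 $ 1 + v * X' $ 1 $ 1 - inverse (u * (y $ 1 - Y) + v * (y' $ 1 - Y'))
          * (u * \<alpha> $ 1 + v * \<alpha>' $ 1)\<^sup>2}"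
      and C: "C \<in> {u * (x $ 2 - \<alpha> $ 2) + v * (x' $ 2 - \<alpha>' $ 2),
        u * X $ 2 $ 2 + v * X' $ 2 $ 2 - inverse (u * (y $ 2 - Y) + v * (y' $ 2 - Y'))
          * (u * \<alpha> $ 2 + v * \<alpha>' $ 2)\<^sup>2}" for A C
  proof -
    have *: "\<exists>B B'. B \<in> {x $ j - \<alpha> $ j, X $ j $ j - inverse (y $ j - Y) * (\<alpha> $ j)\<^sup>2} \<and>
        B' \<in> {x' $ j - \<alpha>' $ j, X' $ j $ j - inverse (y' $ j - Y') * (\<alpha>' $ j)\<^sup>2} \<and>
        u * B + v * B' \<le> D"
      if D: "D \<in> {u * (x $ j - \<alpha> $ j) + v * (x' $ j - \<alpha>' $ j),
        u * X $ j $ j + v * X' $ j $ j - inverse (u * (y $ j - Y) + v * (y' $ j - Y'))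
          * (u * \<alpha> $ j + v * \<alpha>' $ j)\<^sup>2}"
        and j: "0 \<le> \<alpha> $ j" "\<alpha> $ j \<le> y $ j - Y" "0 \<le> \<alpha>' $ j" "\<alpha>' $ j \<le> y' $ j - Y'" for D j
    proof -
      from D consider "D = u * (x $ j - \<alpha> $ j) + v * (x' $ j - \<alpha>' $ j)"
        | "D = u * X $ j $ j + v * X' $ j $ j - inverse (u * (y $ j - Y) + v * (y' $ j - Y'))
          * (u * \<alpha> $ j + v * \<alpha>' $ j)\<^sup>2" by auto
      then show ?thesis
      proof cases
        case 1
        then show ?thesis by blast
      next
        case 2
        have "u * (X $ j $ j - inverse (y $ j - Y) * (\<alpha> $ j)\<^sup>2)
            + v * (X' $ j $ j - inverse (y' $ j - Y') * (\<alpha>' $ j)\<^sup>2) \<le> D"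
          unfolding 2 using quad_over_linear_convex[OF j uv(1,2)]
          by (simp add: right_diff_distrib)
        then show ?thesis by blast
      qed
    qed
    obtain B B' where B: "B \<in> {x $ 1 - \<alpha> $ 1, X $ 1 $ 1 - inverse (y $ 1 - Y) * (\<alpha> $ 1)\<^sup>2}"
      "B' \<in> {x' $ 1 - \<alpha>' $ 1, X' $ 1 $ 1 - inverse (y' $ 1 - Y') * (\<alpha>' $ 1)\<^sup>2}"
      "u * B + v * B' \<le> A"
      using *[OF A] h by blast
    obtain E E' where E: "E \<in> {x $ 2 - \<alpha> $ 2, X $ 2 $ 2 - inverse (y $ 2 - Y) * (\<alpha> $ 2)\<^sup>2}"
      "E' \<in> {x' $ 2 - \<alpha>' $ 2, X' $ 2 $ 2 - inverse (y' $ 2 - Y') * (\<alpha>' $ 2)\<^sup>2}"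
      "u * E + v * E' \<le> C"
      using *[OF C] h by blast
    have "psd3 Y (x $ 1 - \<alpha> $ 1) (x $ 2 - \<alpha> $ 2) B (X $ 1 $ 2) E"
      "psd3 Y' (x' $ 1 - \<alpha>' $ 1) (x' $ 2 - \<alpha>' $ 2) B' (X' $ 1 $ 2) E'"
      using h B(1,2) E(1,2) by blast+
    from psd3_diag_mono[OF psd3_comb[OF this uv(1,2)] B(3) E(3)] show ?thesis .
  qed
  have comb: "(u *\<^sub>R w + v *\<^sub>R w') $ i = u * w $ i + v * w' $ i" for w w' :: "real ^ 2" and i
    by simp
  have comb': "(u *\<^sub>R W + v *\<^sub>R W') $ i $ j = u * W $ i $ j + v * W' $ i $ j"
    for W W' :: "real ^ 2 ^ 2" and i j
    by simp
  have diff: "u * a + v * a' - (u * b + v * b') = u * (a - b) + v * (a' - b')" for a a' b b'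
    by (simp add: algebra_simps)
  \<comment> \<open>Zeros appear as \<open>u * 0 + v * 0\<close> so that \<open>mono\<close> fits
    every conjunct; the constant 1 is recovered later from \<open>u + v = 1\<close>.\<close>
  have "u * X $ 1 $ 1 + v * X' $ 1 $ 1 \<le> u * x $ 1 + v * x' $ 1 \<and>
      u * X $ 2 $ 2 + v * X' $ 2 $ 2 \<le> u * x $ 2 + v * x' $ 2 \<and>
      u * x $ 1 + v * x' $ 1 \<le> u * y $ 1 + v * y' $ 1 \<and>
      u * x $ 2 + v * x' $ 2 \<le> u * y $ 2 + v * y' $ 2 \<and>
      u * 0 + v * 0 \<le> u * X $ 1 $ 2 + v * X' $ 1 $ 2 \<and>
      u * (x $ 1 - \<alpha> $ 1 + x $ 2 - \<alpha> $ 2 - Y) + v * (x' $ 1 - \<alpha>' $ 1 + x' $ 2 - \<alpha>' $ 2 - Y')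
        \<le> u * X $ 1 $ 2 + v * X' $ 1 $ 2 \<and>
      u * X $ 1 $ 2 + v * X' $ 1 $ 2 \<le> u * (x $ 1 - \<alpha> $ 1) + v * (x' $ 1 - \<alpha>' $ 1) \<and>
      u * X $ 1 $ 2 + v * X' $ 1 $ 2 \<le> u * (x $ 2 - \<alpha> $ 2) + v * (x' $ 2 - \<alpha>' $ 2) \<and>
      u * 0 + v * 0 \<le> u * \<alpha> $ 1 + v * \<alpha>' $ 1 \<and>
      u * \<alpha> $ 1 + v * \<alpha>' $ 1 \<le> u * (y $ 1 - Y) + v * (y' $ 1 - Y') \<and>
      u * 0 + v * 0 \<le> u * \<alpha> $ 2 + v * \<alpha>' $ 2 \<and>
      u * \<alpha> $ 2 + v * \<alpha>' $ 2 \<le> u * (y $ 2 - Y) + v * (y' $ 2 - Y') \<and>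
      u * 0 + v * 0 \<le> u * Y + v * Y' \<and>
      u * (y $ 1 + y $ 2 - 1) + v * (y' $ 1 + y' $ 2 - 1) \<le> u * Y + v * Y'"
    by (intro conjI mono) (use h in blast)+
  note ineq = this[unfolded right_diff_distrib distrib_left mult_1_right mult_zero_right]
  have lin: "u * X $ 2 $ 1 + v * X' $ 2 $ 1 = u * X $ 1 $ 2 + v * X' $ 1 $ 2"
    using h by simp
  have "(u *\<^sub>R x + v *\<^sub>R x', u *\<^sub>R X + v *\<^sub>R X', u *\<^sub>R y + v *\<^sub>R y', u *\<^sub>R Y + v *\<^sub>R Y',
      u *\<^sub>R \<alpha> + v *\<^sub>R \<alpha>') \<in> lifted_set"
    unfolding in_lifted_set_iff comb comb' real_scaleR_def
    by (intro conjI ballI psd[folded diff]; (assumption | use ineq uv(3) lin in linarith))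
  then show "u *\<^sub>R (x, X, y, Y, \<alpha>) + v *\<^sub>R (x', X', y', Y', \<alpha>') \<in> lifted_set"
    by simp
qed

section \<open>Lifting the generators, and the equality of the two sets\<close>

text \<open>A one-point distribution lies in a single part: for \<open>y = (1, 1)\<close> nothing is
  left for \<alpha>, otherwise \<alpha> takes all of \<open>x\<close>.\<close>

lemma generator_in_lifted_set:
  fixes x y :: "real ^ 2"
  assumes y: "\<forall>j. y $ j \<in> {0, 1}" and x: "0 \<le> x" "x \<le> y"
  shows "(x, outer_square x, y, y $ 1 * y $ 2, (1 - y $ 1 * y $ 2) *\<^sub>R x) \<in> lifted_set"
proof -
  define Y where "Y = y $ 1 * y $ 2"
  have x': "0 \<le> x $ 1" "x $ 1 \<le> y $ 1" "0 \<le> x $ 2" "x $ 2 \<le> y $ 2"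
    using x by (auto simp: less_eq_vec_def)
  have y': "y $ 1 = 0 \<or> y $ 1 = 1" "y $ 2 = 0 \<or> y $ 2 = 1" using y by auto
  then have Y: "Y \<in> {0, 1}" by (auto simp: Y_def)
  have le: "x $ j * x $ j \<le> x $ j" if "0 \<le> x $ j" "x $ j \<le> y $ j" for j
    using y that mult_left_le[of "x $ j" "x $ j"] by (cases "y $ j = 0") auto
  \<comment> \<open>With equality on the diagonal the form is
    \<open>Y * (a + x $ 1 * b + x $ 2 * c)\<^sup>2\<close>.\<close>
  have psd: "psd3 Y (Y * x $ 1) (Y * x $ 2) A (Y * (x $ 1 * x $ 2)) C"
    if "Y * (x $ 1 * x $ 1) \<le> A" "Y * (x $ 2 * x $ 2) \<le> C" for A C
  proof (rule psd3_diag_mono[OF _ that])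
    have "0 \<le> Y * (a + x $ 1 * b + x $ 2 * c)\<^sup>2" for a b c using Y by auto
    then show "psd3 Y (Y * x $ 1) (Y * x $ 2) (Y * (x $ 1 * x $ 1)) (Y * (x $ 1 * x $ 2))
        (Y * (x $ 2 * x $ 2))"
      by (simp add: psd3_def power2_eq_square algebra_simps)
  qed
  have mc: "x $ 1 + x $ 2 - 1 \<le> x $ 1 * x $ 2" "x $ 1 * x $ 2 \<le> x $ 1" "x $ 1 * x $ 2 \<le> x $ 2"
  proof -
    have "x $ 1 \<le> 1" "x $ 2 \<le> 1" using x' y' by auto
    then show "x $ 1 * x $ 2 \<le> x $ 1" "x $ 1 * x $ 2 \<le> x $ 2"
      using x' by (auto simp: mult_left_le mult_left_le_one_le)
    have "0 \<le> (1 - x $ 1) * (1 - x $ 2)"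
      using \<open>x $ 1 \<le> 1\<close> \<open>x $ 2 \<le> 1\<close> by simp
    then show "x $ 1 + x $ 2 - 1 \<le> x $ 1 * x $ 2" by (simp add: algebra_simps)
  qed
  have psd0: "psd3 0 0 0 0 0 0" by (simp add: psd3_def)
  \<comment> \<open>In the last two cases \<alpha> equals \<open>x\<close> and all entries of the
    four matrices vanish, also when a denominator is 0.\<close>
  consider "y $ 1 = 1" "y $ 2 = 1" "Y = 1" | "y $ 1 = 0" "x $ 1 = 0" "Y = 0"
    | "y $ 2 = 0" "x $ 2 = 0" "Y = 0"
    using y' x' by (auto simp: Y_def)
  then show ?thesis
  proof cases
    case 1
    note psd1 = psd[unfolded 1 mult_1]
    show ?thesis
      using mc x' le[OF x'(1,2)] le[OF x'(3,4)]
      by (simp add: in_lifted_set_iff Y_def[symmetric] 1 outer_square_def psd1)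
  next
    case 2
    show ?thesis
      using y'(2) x' le[OF x'(3,4)]
      by (auto simp: in_lifted_set_iff Y_def[symmetric] 2 outer_square_def power2_eq_square psd0)
  next
    case 3
    show ?thesis
      using y'(1) x' le[OF x'(1,2)]
      by (auto simp: in_lifted_set_iff Y_def[symmetric] 3 outer_square_def power2_eq_square psd0)
  qed
qed

theorem theorem3:
  shows "convex lifted_set \<and>
         hull_H = (\<lambda>(x, X, y, Y, \<alpha>). (x, X, y, Y)) ` lifted_set"
proof (intro conjI convex_lifted_set subset_antisym)
  let ?proj = "\<lambda>(x :: real ^ 2, X :: real ^ 2 ^ 2, y :: real ^ 2, Y :: real, \<alpha> :: real ^ 2). (x, X, y, Y)"
  \<comment> \<open>A linear image of a convex set is convex, so it contains the hull once it
    contains the generators.\<close>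
  have "linear ?proj" by (rule linearI) auto
  then have "convex (?proj ` lifted_set)"
    by (rule convex_linear_image[OF _ convex_lifted_set])
  then show "hull_H \<subseteq> ?proj ` lifted_set"
    unfolding hull_H_def
    by (intro hull_minimal) (auto intro!: rev_image_eqI[OF generator_in_lifted_set])
  show "?proj ` lifted_set \<subseteq> hull_H"
    using lifted_set_imp_hull_H by auto
qed

end
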